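(* Let $(K,|\cdot|)$ be a non-Archimedean nontrivially valued field with ring of integers $D$, and let $n\ge2$. Let $L:=\mathbb Z$ if $\operatorname{char}K=0$, and $L:=D$ if $\operatorname{char}K>0$. Then $K^n$ is $\mathrm{SA}(n,L)$-paradoxical using $5$ pieces.
   Context: A non-Archimedean valuation on a field $K$ is a function $|\cdot|:K\to[0,\infty)$ with $|x|=0\iff x=0$, $|xy|=|x||y|$, $|x+y|\le\max\{|x|,|y|\}$; it is nontrivial if $\{|x|:x\in K,x\neq0\}\ne\{1\}$. $D=\{x\in K:|x|\le1\}$ is the ring of integers. If $\operatorname{char}K=0$, $\mathbb Z$ is regarded as a subring of $K$. For a subring $L\subseteq K$ with $1\in L$, $\mathrm{SA}(n,L)$ is the special affine group, consisting of the maps $x\mapsto M(x)+\tau$ with $M\in\mathrm{SL}(n,L)$ and $\tau\in L^n$, regarded here as acting on $K^n$. For a group $G$ acting on a set $X$ and $A,B\subseteq X$, write $A\sim_{G,m}B$ if there are partitions $A=\bigsqcup_{i=1}^mA_i$, $B=\bigsqcup_{i=1}^mB_i$ into (possibly empty) subsets and $g_1,\dots,g_m\in G$ with $g_i(A_i)=B_i$. A nonempty set $E\subseteq X$ is $G$-paradoxical using $s$ pieces if $E=A\sqcup B$ with $A\sim_{G,m}E$ and $B\sim_{G,l}E$ for some $m,l\ge1$ with $m+l=s$. The axiom of choice is assumed. *)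

theory Defs
  imports "HOL-Analysis.Analysis" "HOL-Computational_Algebra.Computational_Algebra"
begin

locale nonarch_valuation =
  fixes v :: "'k::field \<Rightarrow> real"
  assumes nonneg: "v x \<ge> 0"
    and eq_zero_iff: "v x = 0 \<longleftrightarrow> x = 0"
    and mult: "v (x * y) = v x * v y"
    and ultrametric: "v (x + y) \<le> max (v x) (v y)"

definition nontrivial_valuation :: "('k::field \<Rightarrow> real) \<Rightarrow> bool" where
  "nontrivial_valuation v \<longleftrightarrow> {v x | x. x \<noteq> 0} \<noteq> {1}"

definition ring_of_integers :: "('k::field \<Rightarrow> real) \<Rightarrow> 'k set" where
  "ring_of_integers v = {x. v x \<le> 1}"

text \<open>In the next two definitions \<open>L\<close> is meant to be a subring of \<open>'k\<close> containing \<open>1\<close>.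
  For \<open>L = \<int>\<close> this is the image of the integers in \<open>'k\<close>.\<close>

definition special_linear :: "'k::field set \<Rightarrow> ('k ^ 'n ^ 'n) set" where
  "special_linear L = {M. (\<forall>i j. M $ i $ j \<in> L) \<and> det M = 1}"

definition special_affine :: "'k::field set \<Rightarrow> ('k ^ 'n \<Rightarrow> 'k ^ 'n) set" where
  "special_affine L =
     {(\<lambda>x. M *v x + \<tau>) | M \<tau>. M \<in> special_linear L \<and> (\<forall>i. \<tau> $ i \<in> L)}"

text \<open>A group acting on a type \<open>'x\<close> enters the notions below only through the
  set \<open>G\<close> of transformations of \<open>'x\<close> by which its elements act. Pieces may be empty.\<close>

definition equidecomposable ::
    "('x \<Rightarrow> 'x) set \<Rightarrow> nat \<Rightarrow> 'x set \<Rightarrow> 'x set \<Rightarrow> bool" where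
  "equidecomposable G m A B \<longleftrightarrow>
     (\<exists>P Q g. disjoint_family_on P {..<m} \<and> (\<Union>i<m. P i) = A \<and>
              disjoint_family_on Q {..<m} \<and> (\<Union>i<m. Q i) = B \<and>
              (\<forall>i<m. g i \<in> G \<and> g i ` P i = Q i))"

definition paradoxical_using :: "('x \<Rightarrow> 'x) set \<Rightarrow> nat \<Rightarrow> 'x set \<Rightarrow> bool" where
  "paradoxical_using G s E \<longleftrightarrow>
     E \<noteq> {} \<and>
     (\<exists>A B m l. A \<inter> B = {} \<and> A \<union> B = E \<and> m \<ge> 1 \<and> l \<ge> 1 \<and> m + l = s \<and>
                equidecomposable G m A E \<and> equidecomposable G l B E)"

end

theory Submission
  imports Defs
begin

text \<open>Let \<open>A\<close> and \<open>B\<close> be the upper and lower elementary matrices of size 2. For suitable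
  \<open>f \<noteq> g\<close> in \<open>L\<close> the matrices \<open>A(f)B(f)\<close> and \<open>A(g)B(g)\<close> generate a free group none of whose
  nontrivial elements has the eigenvalue 1: ping-pong with respect to an absolute value at
  infinity, the usual one on \<open>\<int>\<close> or \<open>3\<close> to the degree on \<open>F\<^sub>p[t]\<close> with \<open>0 < \<bar>t\<bar> < 1\<close>, where \<open>f = t\<close>
  and \<open>g = t\<^sup>2\<close>. Hence this group acts freely on the nonzero vectors of the plane. The 4-piece
  paradox of a free action can be arranged to leave out one point, say \<open>(1, 0)\<close>. The origin
  joins a piece that is not moved, and in the other half of the paradox it is supplied by
  translating the fifth piece \<open>{(1, 0)}\<close> to it. In dimension \<open>n\<close>, take preimages under the
  projection to two coordinates.\<close>

section \<open>Paradoxical decompositions from two free generators\<close>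

text \<open>A letter \<open>(i, e)\<close> is the generator with index \<open>i\<close> if \<open>e\<close> holds, and its inverse otherwise.\<close>

type_synonym letter = "bool \<times> bool"

section \<open>Reduced words in two letters and their inverses\<close>

definition letter_inv :: "letter \<Rightarrow> letter" where
  "letter_inv s = (fst s, \<not> snd s)"

lemma letter_inv_inv [simp]: "letter_inv (letter_inv s) = s"
  by (simp add: letter_inv_def)

lemma letter_inv_neq [simp]: "letter_inv s \<noteq> s" "s \<noteq> letter_inv s"
  by (auto simp: letter_inv_def prod_eq_iff)

lemma letter_inv_eq_iff [simp]: "letter_inv s = letter_inv t \<longleftrightarrow> s = t"
  by (auto simp: letter_inv_def prod_eq_iff)

definition reduced_word :: "letter list \<Rightarrow> bool" where
  "reduced_word = successively (\<lambda>s t. t \<noteq> letter_inv s)"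

definition word_inv :: "letter list \<Rightarrow> letter list" where
  "word_inv w = rev (map letter_inv w)"

lemma reduced_word_Nil [simp]: "reduced_word []"
  by (simp add: reduced_word_def)

lemma reduced_word_Cons: "reduced_word (s # w) \<longleftrightarrow> w = [] \<or> hd w \<noteq> letter_inv s \<and> reduced_word w"
  by (auto simp: reduced_word_def successively_Cons)

lemma reduced_word_append:
  "reduced_word (w @ w') \<longleftrightarrow>
     reduced_word w \<and> reduced_word w' \<and> (w = [] \<or> w' = [] \<or> hd w' \<noteq> letter_inv (last w))"
  by (auto simp: reduced_word_def successively_append_iff)

lemma word_inv_eq_Nil [simp]: "word_inv w = [] \<longleftrightarrow> w = []"
  by (simp add: word_inv_def)

lemma last_word_inv: "w \<noteq> [] \<Longrightarrow> last (word_inv w) = letter_inv (hd w)"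
  by (simp add: word_inv_def last_rev hd_map)

lemma reduced_word_inv: "reduced_word w \<Longrightarrow> reduced_word (word_inv w)"
proof (induction w)
  case (Cons s w)
  then have "w = [] \<or> last (word_inv w) \<noteq> s"
    by (auto simp: reduced_word_Cons last_word_inv)
  moreover have "word_inv (s # w) = word_inv w @ [letter_inv s]"
    by (simp add: word_inv_def)
  ultimately show ?case
    using Cons by (auto simp: reduced_word_append reduced_word_Cons)
qed (simp add: word_inv_def)

locale invertible_letters =
  fixes act :: "letter \<Rightarrow> 'x \<Rightarrow> 'x"
  assumes act_letter_inv: "act (letter_inv s) (act s x) = x"
begin

lemma act_act_letter_inv: "act s (act (letter_inv s) x) = x"
  using act_letter_inv[of "letter_inv s"] by simp

lemma act_inject: "act s x = act s y \<longleftrightarrow> x = y"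
  by (metis act_letter_inv)

text \<open>\<open>foldr\<close> lets the last letter act first, so \<open>hd w\<close> is the
  letter applied last.\<close>

abbreviation word :: "letter list \<Rightarrow> 'x \<Rightarrow> 'x" where
  "word w \<equiv> foldr act w"

lemma word_word_inv: "word (word_inv w) (word w x) = x"
  by (induction w arbitrary: x) (simp_all add: word_inv_def act_letter_inv)

text \<open>Prepending a letter keeps a reduced word reduced unless the head is its inverse; then
  dropping that head gives the reduced word.\<close>

lemma word_eq_reduced: "\<exists>w'. reduced_word w' \<and> word w x = word w' x"
proof (induction w)
  case (Cons s w)
  then obtain w' where w': "reduced_word w'" "word w x = word w' x"
    by blast
  show ?case
  proof (cases "w' \<noteq> [] \<and> hd w' = letter_inv s")
    case True
    then obtain u where u: "w' = letter_inv s # u"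
      by (metis list.collapse)
    then have "word (s # w) x = word u x"
      using w' by (simp add: act_act_letter_inv)
    then show ?thesis
      using w' u by (metis reduced_word_Cons reduced_word_Nil)
  next
    case False
    then have "reduced_word (s # w')"
      using w' by (auto simp: reduced_word_Cons)
    then show ?thesis
      using w'(2) by (intro exI[of _ "s # w'"]) simp
  qed
qed (auto intro: exI[of _ "[]"])

end

locale free_letters = invertible_letters act for act :: "letter \<Rightarrow> 'x \<Rightarrow> 'x" +
  fixes X :: "'x set"
  assumes act_in: "x \<in> X \<Longrightarrow> act s x \<in> X"
    and fixed_point_free: "\<lbrakk>reduced_word w; w \<noteq> []; x \<in> X\<rbrakk> \<Longrightarrow> word w x \<noteq> x"
begin

lemma word_in: "x \<in> X \<Longrightarrow> word w x \<in> X"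
  by (induction w) (auto intro: act_in)

text \<open>Equal first letters cancel. If they differ, the inverse of one word followed by the
  other has no cancellation at the joint, so a nonempty reduced word fixes \<open>x\<close>, against
  freeness.\<close>

lemma reduced_word_unique:
  assumes "reduced_word w" "reduced_word w'" "word w x = word w' x" "x \<in> X"
  shows "w = w'"
  using assms(1-3)
proof (induction w arbitrary: w')
  case Nil
  then show ?case
    using fixed_point_free[of w' x] assms(4) by force
next
  case (Cons s w w'')
  show ?case
  proof (cases w'')
    case Nil
    then show ?thesis
      using Cons.prems fixed_point_free[of "s # w" x] assms(4) by force
  next
    case (Cons t w')
    show ?thesis
    proof (cases "s = t")
      case True
      with Cons Cons.prems have "word w x = word w' x" "reduced_word w" "reduced_word w'"
        by (auto simp: act_inject reduced_word_Cons)
      then have "w = w'"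
        by (intro Cons.IH)
      then show ?thesis
        using True Cons by simp
    next
      case False
      have "word (word_inv w'' @ s # w) x = x"
        using Cons.prems(3) word_word_inv[of w'' x] by simp
      moreover have "reduced_word (word_inv w'' @ s # w)"
        using Cons.prems False Cons last_word_inv[of w''] reduced_word_inv[of w'']
        by (simp add: reduced_word_append)
      ultimately show ?thesis
        using fixed_point_free assms(4) by blast
    qed
  qed
qed

section \<open>Orbits and normal forms of a free action\<close>

definition orbit :: "'x \<Rightarrow> 'x set" where
  "orbit x = {word w x | w. True}"

lemma self_in_orbit: "x \<in> orbit x"
  unfolding orbit_def by (auto intro: exI[of _ "[]"])

lemma orbit_word: "orbit (word w x) = orbit x"
proof -
  have sub: "orbit (word u y) \<subseteq> orbit y" for u y
    unfolding orbit_def by (auto simp flip: foldr_append comp_apply[of "word _" "word _"])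
  show ?thesis
    using sub[of w x] sub[of "word_inv w" "word w x"] by (auto simp: word_word_inv)
qed

text \<open>One base point per orbit identifies each orbit in \<open>X\<close> with the reduced
  words. The orbit of \<open>p\<close> is based at \<open>p\<close> itself, so that \<open>p\<close>
  gets the empty normal form.\<close>

lemma normal_forms:
  assumes "p \<in> X"
  obtains rep nf where
    "\<And>x. x \<in> X \<Longrightarrow> rep x \<in> X"
    "\<And>x. reduced_word (nf x)"
    "\<And>x. word (nf x) (rep x) = x"
    "\<And>s x. rep (act s x) = rep x"
    "rep p = p"
proof -
  \<comment> \<open>The value depends on \<open>x\<close> only through \<open>orbit x\<close>, which
    makes \<open>rep\<close> constant on orbits.\<close>
  define rep where "rep x = (if p \<in> orbit x then p else (SOME y. y \<in> orbit x))" for x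
  have rep: "rep x \<in> orbit x" for x
    unfolding rep_def using self_in_orbit someI[of "\<lambda>y. y \<in> orbit x"] by auto
  have "\<exists>w. reduced_word w \<and> word w (rep x) = x" for x
  proof -
    obtain u where "rep x = word u x"
      using rep by (auto simp: orbit_def)
    then have "word (word_inv u) (rep x) = x"
      by (simp add: word_word_inv)
    then show ?thesis
      by (metis word_eq_reduced)
  qed
  then obtain nf where nf: "\<And>x. reduced_word (nf x)" "\<And>x. word (nf x) (rep x) = x"
    by metis
  have "rep (act s x) = rep x" for s x
    using orbit_word[of "[s]" x] by (simp add: rep_def)
  moreover have "rep x \<in> X" if "x \<in> X" for x
    using rep[of x] word_in[OF that] by (auto simp: orbit_def)
  moreover have "rep p = p"
    by (simp add: rep_def self_in_orbit)
  ultimately show ?thesis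
    using nf that by blast
qed

text \<open>The classical decomposition of a free group of rank two by first letters leaves out the
  neutral element. In the orbit of \<open>p\<close> this leftover is kept; in all other
  orbits it is absorbed, together with all powers of the inverse of the first generator, by the
  first piece.\<close>

theorem paradoxical_minus_point:
  assumes "p \<in> X"
  obtains A1 A2 A3 A4 where
    "A1 \<inter> A2 = {}" "A3 \<inter> A4 = {}" "(A1 \<union> A2) \<inter> (A3 \<union> A4) = {}"
    "A1 \<union> A2 \<union> A3 \<union> A4 = X - {p}"
    "act (False, True) ` A2 = X - A1"
    "act (True, True) ` A4 = X - A3"
proof -
  obtain rep nf where rep: "\<And>x. x \<in> X \<Longrightarrow> rep x \<in> X"
    and nf: "\<And>x. reduced_word (nf x)" "\<And>x. word (nf x) (rep x) = x"
    and rep_act: "\<And>s x. rep (act s x) = rep x" and rep_p: "rep p = p"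
    using normal_forms[OF assms] by metis
  have nf_eqI: "nf x = w" if "x \<in> X" "reduced_word w" "word w (rep x) = x" for x w
    using reduced_word_unique[of "nf x" w "rep x"] that nf rep by simp
  have nf_push: "nf (act s x) = s # nf x"
    if "x \<in> X" "nf x = [] \<or> hd (nf x) \<noteq> letter_inv s" for s x
    using that nf(1)[of x] by (intro nf_eqI act_in) (auto simp: reduced_word_Cons rep_act nf(2))
  have nf_pop: "nf (act s x) = u" if "x \<in> X" "nf x = letter_inv s # u" for s x u
  proof (intro nf_eqI act_in)
    show "reduced_word u"
      using nf(1)[of x] that(2) by (auto simp: reduced_word_Cons)
    have "act (letter_inv s) (word u (rep x)) = x"
      using nf(2)[of x] that(2) by simp
    then show "word u (rep (act s x)) = act s x"
      by (metis act_act_letter_inv rep_act)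
  qed (use that in auto)
  define W where "W s = {x \<in> X. nf x \<noteq> [] \<and> hd (nf x) = s}" for s
  \<comment> \<open>The first-letter paradox of the free group in pointwise form: \<open>s\<close>
    carries \<open>W (letter_inv s)\<close> onto the complement of \<open>W s\<close> in
    \<open>X\<close>.\<close>
  have W_iff: "act (letter_inv s) y \<in> W (letter_inv s) \<longleftrightarrow> y \<notin> W s" if "y \<in> X" for s y
  proof (cases "y \<in> W s")
    case True
    then obtain u where u: "nf y = s # u"
      by (cases "nf y") (auto simp: W_def)
    then have "nf (act (letter_inv s) y) = u"
      using nf_pop[of y "letter_inv s"] that by simp
    moreover have "u = [] \<or> hd u \<noteq> letter_inv s"
      using nf(1)[of y] u by (auto simp: reduced_word_Cons)
    ultimately show ?thesis
      using True by (auto simp: W_def)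
  next
    case False
    then have "nf (act (letter_inv s) y) = letter_inv s # nf y"
      using that by (intro nf_push) (auto simp: W_def)
    then show ?thesis
      using False that by (auto simp: W_def act_in)
  qed
  have image_eq: "act s ` B = X - A"
    if "B \<subseteq> X" "\<And>y. y \<in> X \<Longrightarrow> act (letter_inv s) y \<in> B \<longleftrightarrow> y \<notin> A" for s A B
  proof (intro equalityI subsetI)
    fix y assume "y \<in> act s ` B"
    then obtain x where x: "x \<in> B" "y = act s x"
      by blast
    then have "y \<in> X"
      using that(1) act_in by blast
    then show "y \<in> X - A"
      using that(2)[of y] x by (simp add: act_letter_inv)
  next
    fix y assume "y \<in> X - A"
    then show "y \<in> act s ` B"
      using that(2) act_act_letter_inv[of s y] by (intro rev_image_eqI) auto
  qed
  let ?a = "(False, True)" and ?a' = "(False, False)" and ?b = "(True, True)" and ?b' = "(True, False)"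
  have inv: "letter_inv ?a = ?a'" "letter_inv ?b = ?b'"
    by (simp_all add: letter_inv_def)
  \<comment> \<open>\<open>n = 0\<close> is allowed, so \<open>Z\<close> contains the base points in
    \<open>X\<close> other than \<open>p\<close>.\<close>
  define Z where "Z = {x \<in> X. rep x \<noteq> p \<and> (\<exists>n. nf x = replicate n ?a')}"
  have "act ?a ` (W ?a' - Z) = X - (W ?a \<union> Z)"
  proof (rule image_eq, unfold inv)
    fix y assume y: "y \<in> X"
    show "act ?a' y \<in> W ?a' - Z \<longleftrightarrow> y \<notin> W ?a \<union> Z"
    proof (cases "y \<in> W ?a")
      case False
      then have "nf (act ?a' y) = ?a' # nf y"
        using y inv by (intro nf_push) (auto simp: W_def letter_inv_def)
      \<comment> \<open>Prefixing \<open>?a'\<close> turns powers of \<open>?a'\<close> into powers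
        and non-powers into non-powers; for this, \<open>Z\<close> contains all powers and not just
        the base points.\<close>
      moreover have "(\<exists>n. ?a' # nf y = replicate n ?a') \<longleftrightarrow> (\<exists>n. nf y = replicate n ?a')"
        by (metis length_Cons length_replicate list.inject replicate_Suc)
      ultimately have "act ?a' y \<in> Z \<longleftrightarrow> y \<in> Z"
        using y by (auto simp: Z_def rep_act act_in)
      then show ?thesis
        using W_iff[OF y, of ?a] inv False by simp
    qed (use W_iff[OF y, of ?a] inv in simp)
  qed (auto simp: W_def)
  moreover have "act ?b ` W ?b' = X - W ?b"
    using W_iff[of _ ?b] inv by (intro image_eq) (auto simp: W_def)
  moreover have Z_sub: "Z \<inter> (W ?b \<union> W ?b') = {}"
    by (force simp: Z_def W_def hd_replicate)
  moreover have "(W ?a \<union> Z) \<union> (W ?a' - Z) \<union> W ?b \<union> W ?b' = X - {p}"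
  proof -
    have "nf p = []"
      using nf_eqI[of p "[]"] assms rep_p by simp
    then have "p \<notin> W s" "p \<notin> Z" for s
      using rep_p by (auto simp: W_def Z_def)
    moreover have "W s \<subseteq> X" "Z \<subseteq> X" for s
      by (auto simp: W_def Z_def)
    moreover have "x \<in> W ?a \<union> Z \<union> W ?a' \<union> W ?b \<union> W ?b'" if "x \<in> X" "x \<noteq> p" for x
    proof (cases "nf x = []")
      case True
      then have "x \<in> Z"
        using that nf(2)[of x] by (auto simp: Z_def intro: exI[of _ 0])
      then show ?thesis
        by simp
    next
      case False
      then show ?thesis
        using that by (cases "hd (nf x)") (auto simp: W_def)
    qed
    ultimately show ?thesis
      by blast
  qed
  moreover have "(W ?a \<union> Z \<union> (W ?a' - Z)) \<inter> (W ?b \<union> W ?b') = {}"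
    using Z_sub by (auto simp: W_def)
  moreover have "(W ?a \<union> Z) \<inter> (W ?a' - Z) = {}" "W ?b \<inter> W ?b' = {}"
    by (auto simp: W_def)
  ultimately show ?thesis
    using that[of "W ?a \<union> Z" "W ?a' - Z" "W ?b" "W ?b'"] by blast
qed

end

section \<open>Ping-pong with products of two transvections\<close>

text \<open>A single transvection fixes a line pointwise, so each generator is a product of two, the
  lower one acting first.\<close>

fun sl2_act :: "(bool \<Rightarrow> 'k) \<Rightarrow> letter \<Rightarrow> 'k \<times> 'k \<Rightarrow> 'k::comm_ring_1 \<times> 'k" where
  "sl2_act f (i, True) (x, y) = (x + f i * (y + f i * x), y + f i * x)"
| "sl2_act f (i, False) (x, y) = (x - f i * y, y - f i * (x - f i * y))"

interpretation sl2: invertible_letters "sl2_act f" for f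
proof
  show "sl2_act f (letter_inv s) (sl2_act f s x) = x" for s x
    by (cases "(f, s, x)" rule: sl2_act.cases) (auto simp: letter_inv_def)
qed

lemma sl2_act_zero: "sl2_act f s (0, 0) = (0, 0)"
  by (cases "(f, s, (0::'a, 0::'a))" rule: sl2_act.cases) auto

lemma sl2_act_eq_zero_iff: "sl2_act f s u = (0, 0) \<longleftrightarrow> u = (0, 0)"
  by (metis sl2.act_letter_inv sl2_act_zero)

text \<open>\<open>N\<close> models an absolute value at infinity: the given valuation is at most 1
  on \<open>\<int>\<close> and on the ring of integers, so it cannot drive an expansion
  there.\<close>

locale normed_subring =
  fixes S :: "'k::field set" and N :: "'k \<Rightarrow> real"
  assumes zero_in: "0 \<in> S" and one_in: "1 \<in> S"
    and diff_in: "\<lbrakk>x \<in> S; y \<in> S\<rbrakk> \<Longrightarrow> x - y \<in> S"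
    and mult_in: "\<lbrakk>x \<in> S; y \<in> S\<rbrakk> \<Longrightarrow> x * y \<in> S"
    and N_pos: "\<lbrakk>x \<in> S; x \<noteq> 0\<rbrakk> \<Longrightarrow> N x > 0"
    and N_zero: "N 0 = 0"
    and N_mult: "\<lbrakk>x \<in> S; y \<in> S\<rbrakk> \<Longrightarrow> N (x * y) = N x * N y"
    and N_diff: "\<lbrakk>x \<in> S; y \<in> S\<rbrakk> \<Longrightarrow> N (x - y) \<le> N x + N y"
begin

lemma uminus_in: "x \<in> S \<Longrightarrow> - x \<in> S"
  using diff_in[OF zero_in] by simp

lemma add_in: "\<lbrakk>x \<in> S; y \<in> S\<rbrakk> \<Longrightarrow> x + y \<in> S"
  using diff_in[of x "- y"] uminus_in by simp

lemma N_nonneg: "x \<in> S \<Longrightarrow> N x \<ge> 0"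
  using N_pos[of x] N_zero by (cases "x = 0") auto

lemma N_uminus: "x \<in> S \<Longrightarrow> N (- x) = N x"
  using N_diff[of 0 x] N_diff[of 0 "- x"] zero_in uminus_in[of x] by (simp add: N_zero)

lemma N_reverse_triangle: "\<lbrakk>x \<in> S; y \<in> S\<rbrakk> \<Longrightarrow> N x \<le> N (x + y) + N y"
  using N_diff[of "x + y" y] add_in[of x y] by simp

lemmas closed = zero_in one_in diff_in mult_in uminus_in add_in

end

locale ping_pong = normed_subring S N for S :: "'k::field set" and N +
  fixes f :: "bool \<Rightarrow> 'k"
  assumes f_in: "f i \<in> S"
    and N_f: "N (f i) > 2"
    and N_f_diff: "i \<noteq> j \<Longrightarrow> N (f i - f j) > 2"
begin

text \<open>Writing the positive generators as \<open>U L\<close> with \<open>U\<close> upper and \<open>L\<close> lower unitriangular,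
  the attracting cone of \<open>U L\<close> is the image under \<open>U\<close> of the cone \<open>N x \<le> N y\<close>, and that of its
  inverse is the image under \<open>L\<^sup>-\<^sup>1\<close> of \<open>N y \<le> N x\<close>.\<close>

fun cone :: "letter \<Rightarrow> 'k \<times> 'k \<Rightarrow> bool" where
  "cone (i, True) (x, y) \<longleftrightarrow> N (x - f i * y) \<le> N y"
| "cone (i, False) (x, y) \<longleftrightarrow> N (y + f i * x) \<le> N x"

text \<open>The progress measure of ping-pong: its strict growth certifies that a vector has
  moved.\<close>

definition height :: "'k \<times> 'k \<Rightarrow> real" where
  "height u = min (N (fst u)) (N (snd u))"

text \<open>\<open>N (c * y)\<close> exceeds \<open>2 * N y\<close>, and adding \<open>x\<close>
  costs at most \<open>N y\<close>; this is the source of the bound 2.\<close>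

lemma large_multiple:
  assumes "x \<in> S" "y \<in> S" "N x \<le> N y" "y \<noteq> 0" "c \<in> S" "N c > 2"
  shows "N (x + c * y) > N y"
proof -
  have "N (c * y) \<le> N (c * y + x) + N x"
    using assms by (intro N_reverse_triangle closed)
  moreover have "N (c * y) > 2 * N y"
    using assms N_pos[of y] by (simp add: N_mult)
  ultimately show ?thesis
    using assms(3) by (simp add: add.commute)
qed

lemma sl2_act_in: "u \<in> S \<times> S \<Longrightarrow> sl2_act f s u \<in> S \<times> S"
  by (cases "(f, s, u)" rule: sl2_act.cases) (auto intro!: closed f_in)

text \<open>On nonzero vectors, positive cones lie in \<open>N x > N y\<close> and negative ones in
  \<open>N y > N x\<close>. Two cones of the same sign are separated by \<open>f i - f j\<close>,
  whose norm exceeds 2.\<close>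

lemma cone_disjoint:
  assumes "u \<in> S \<times> S" "u \<noteq> (0, 0)" "cone s u" "cone t u"
  shows "s = t"
proof -
  obtain x y where u: "u = (x, y)" and xy: "x \<in> S" "y \<in> S"
    using assms(1) by auto
  have pos: "N x > N y" if c: "cone (i, True) u" for i
  proof -
    have "y \<noteq> 0"
    proof
      assume "y = 0"
      then show False
        using assms(2) c u xy N_pos[of x] by (auto simp: N_zero)
    qed
    then show ?thesis
      using large_multiple[of "x - f i * y" y "f i"] c u xy N_f f_in closed by auto
  qed
  have neg: "N y > N x" if c: "cone (i, False) u" for i
  proof -
    have "x \<noteq> 0"
    proof
      assume "x = 0"
      then show False
        using assms(2) c u xy N_pos[of y] by (auto simp: N_zero)
    qed
    then show ?thesis
      using large_multiple[of "y + f i * x" x "- f i"] c u xy N_f f_in closed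
      by (auto simp: N_uminus)
  qed
  have pos_eq: "i = j" if c: "cone (i, True) u" "cone (j, True) u" for i j
  proof (rule ccontr)
    assume "i \<noteq> j"
    have "y \<noteq> 0"
      using pos[OF c(1)] assms(2) c u xy N_pos[of x] by (auto simp: N_zero)
    then have "N (x - f i * y + (f i - f j) * y) > N y"
      using \<open>i \<noteq> j\<close> c u xy N_f_diff[of i j] f_in closed by (intro large_multiple) auto
    moreover have "x - f i * y + (f i - f j) * y = x - f j * y"
      by (simp add: algebra_simps)
    ultimately show False
      using c(2) u by simp
  qed
  have neg_eq: "i = j" if c: "cone (i, False) u" "cone (j, False) u" for i j
  proof (rule ccontr)
    assume "i \<noteq> j"
    have "x \<noteq> 0"
      using neg[OF c(1)] assms(2) c u xy N_pos[of y] by (auto simp: N_zero)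
    then have "N (y + f i * x + (f j - f i) * x) > N x"
      using \<open>i \<noteq> j\<close> c u xy N_f_diff[of j i] f_in closed by (intro large_multiple) auto
    moreover have "y + f i * x + (f j - f i) * x = y + f j * x"
      by (simp add: algebra_simps)
    ultimately show False
      using c(2) u by simp
  qed
  obtain i d j e where s: "s = (i, d)" and t: "t = (j, e)"
    by fastforce
  show ?thesis
    using assms(3,4) pos[of i] pos[of j] neg[of i] neg[of j] pos_eq[of i j] neg_eq[of i j]
    unfolding s t by (cases d; cases e) auto
qed

text \<open>Outside the cone of the inverse, the coordinate changed by the first transvection
  becomes the larger one. The second then pushes the other coordinate beyond it, so the new height
  is the norm reached in the first step, which exceeds that of an old coordinate.\<close>

lemma sl2_act_outside_cone:
  assumes "u \<in> S \<times> S" "\<not> cone (letter_inv s) u"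
  shows "cone s (sl2_act f s u) \<and> height (sl2_act f s u) > height u"
proof -
  obtain x y where u: "u = (x, y)" and xy: "x \<in> S" "y \<in> S"
    using assms(1) by auto
  obtain i e where s: "s = (i, e)"
    by fastforce
  show ?thesis
  proof (cases e)
    case True
    define Y where "Y = y + f i * x"
    have Y: "Y \<in> S" "N Y > N x"
      using assms xy f_in closed by (auto simp: s u True letter_inv_def Y_def)
    then have "Y \<noteq> 0"
      using N_nonneg[OF xy(1)] by (auto simp: N_zero)
    then have "N (x + f i * Y) > N Y"
      using Y xy f_in N_f by (intro large_multiple) auto
    then show ?thesis
      using Y by (auto simp: s u True height_def simp flip: Y_def)
  next
    case False
    define V where "V = x - f i * y"
    have V: "V \<in> S" "N V > N y"
      using assms xy f_in closed by (auto simp: s u False letter_inv_def V_def)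
    then have "V \<noteq> 0"
      using N_nonneg[OF xy(2)] by (auto simp: N_zero)
    then have "N (y + (- f i) * V) > N V"
      using V xy f_in N_f closed by (intro large_multiple) (auto simp: N_uminus)
    then show ?thesis
      using V by (auto simp: s u False height_def simp flip: V_def)
  qed
qed

lemma word_in_S: "u \<in> S \<times> S \<Longrightarrow> sl2.word f w u \<in> S \<times> S"
  by (induction w) (simp_all add: sl2_act_in del: mem_Times_iff)

text \<open>Each letter lands in its own cone, which by reducedness and disjointness avoids the cone
  forbidden for the next letter.\<close>

lemma word_outside_cone:
  assumes "u \<in> S \<times> S" "reduced_word w" "w \<noteq> []" "\<not> cone (letter_inv (last w)) u"
  shows "cone (hd w) (sl2.word f w u) \<and> height (sl2.word f w u) > height u"
  using assms(2-4)
proof (induction w)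
  case (Cons s w)
  show ?case
  proof (cases "w = []")
    case True
    then show ?thesis
      using sl2_act_outside_cone[OF assms(1), of s] Cons.prems by simp
  next
    case False
    let ?u = "sl2.word f w u"
    have IH: "cone (hd w) ?u" "height ?u > height u"
      using Cons False by (auto simp: reduced_word_Cons)
    \<comment> \<open>The zero vector lies in every cone, so the assumption on the last letter
      excludes it.\<close>
    have "u \<noteq> (0, 0)"
    proof
      assume "u = (0, 0)"
      then show False
        using Cons.prems(3) by (cases "letter_inv (last (s # w))"; cases "snd (letter_inv (last (s # w)))") auto
    qed
    then have "?u \<noteq> (0, 0)"
      by (induction w) (simp_all add: sl2_act_eq_zero_iff)
    moreover have "hd w \<noteq> letter_inv s"
      using Cons.prems(1) False by (simp add: reduced_word_Cons)
    ultimately have "\<not> cone (letter_inv s) ?u"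
      using cone_disjoint[OF word_in_S[OF assms(1)] _ IH(1)] by blast
    then show ?thesis
      using sl2_act_outside_cone[OF word_in_S[OF assms(1)]] IH(2) by fastforce
  qed
qed simp

text \<open>Growth of the height forces a fixed vector into
  \<open>cone (letter_inv (last w))\<close>, and the inverse word forces it into
  \<open>cone (hd w)\<close>. So the first and last letters of \<open>w\<close> are mutually
  inverse, and conjugating them away leaves a shorter word with a nonzero fixed vector.\<close>

lemma fixed_point_free_S:
  assumes "reduced_word w" "w \<noteq> []" "u \<in> S \<times> S" "u \<noteq> (0, 0)"
  shows "sl2.word f w u \<noteq> u"
  using assms
proof (induction "length w" arbitrary: w u rule: less_induct)
  case less
  show ?case
  proof
    assume fixed: "sl2.word f w u = u"
    then have fixed': "sl2.word f (word_inv w) u = u"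
      using sl2.word_word_inv[of f w u] by simp
    have "cone (letter_inv (last w)) u"
      using word_outside_cone[of u w] less.prems fixed by force
    moreover have "cone (hd w) u"
      using word_outside_cone[of u "word_inv w"] reduced_word_inv less.prems fixed' last_word_inv[of w]
      by force
    ultimately have hd_last: "hd w = letter_inv (last w)"
      using cone_disjoint less.prems by blast
    obtain s v where w: "w = s # v"
      using less.prems(2) by (cases w) auto
    have "v \<noteq> []"
      using hd_last w by auto
    then obtain v' where v': "w = s # v' @ [letter_inv s]"
      using w hd_last by (metis append_butlast_last_id last_ConsR letter_inv_inv list.sel(1))
    let ?u = "sl2_act f (letter_inv s) u"
    have "sl2.word f v' ?u = ?u"
      using fixed sl2.act_letter_inv[of f s "sl2.word f v' ?u"] v' by simp
    \<comment> \<open>\<open>v'\<close> cannot be empty, since \<open>[s, letter_inv s]\<close> is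
      not reduced.\<close>
    moreover have "reduced_word v'" "v' \<noteq> []"
      using less.prems(1) v' by (auto simp: reduced_word_append reduced_word_Cons)
    ultimately show False
      using less.hyps[of v' ?u] v' less.prems(3,4) sl2_act_in[of u "letter_inv s"]
      by (simp add: sl2_act_eq_zero_iff)
  qed
qed

text \<open>With the entries in \<open>S\<close>, kernel vectors of the matrix minus the identity
  can be found in \<open>S \<times> S\<close>.\<close>

lemma word_linear:
  obtains a b c d where "a \<in> S" "b \<in> S" "c \<in> S" "d \<in> S"
    "\<And>x y. sl2.word f w (x, y) = (a * x + b * y, c * x + d * y)"
proof -
  have "\<exists>a\<in>S. \<exists>b\<in>S. \<exists>c\<in>S. \<exists>d\<in>S. \<forall>x y. sl2.word f w (x, y) = (a * x + b * y, c * x + d * y)"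
  proof (induction w)
    case Nil
    show ?case
      by (intro bexI[of _ 1] bexI[of _ 0]) (auto simp: closed)
  next
    case (Cons s w)
    then obtain a b c d where abcd: "a \<in> S" "b \<in> S" "c \<in> S" "d \<in> S"
      and eq: "\<And>x y. sl2.word f w (x, y) = (a * x + b * y, c * x + d * y)"
      by blast
    obtain i e where s: "s = (i, e)"
      by fastforce
    note f_i = f_in[of i]
    show ?case
    proof (cases e)
      case True
      show ?thesis
        by (rule bexI[of _ "a + f i * (c + f i * a)"], rule bexI[of _ "b + f i * (d + f i * b)"],
            rule bexI[of _ "c + f i * a"], rule bexI[of _ "d + f i * b"])
          (use abcd f_i in \<open>auto simp: eq s True algebra_simps intro!: closed\<close>)
    next
      case False
      show ?thesis
        by (rule bexI[of _ "a - f i * c"], rule bexI[of _ "b - f i * d"],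
            rule bexI[of _ "c - f i * (a - f i * c)"], rule bexI[of _ "d - f i * (b - f i * d)"])
          (use abcd f_i in \<open>auto simp: eq s False algebra_simps intro!: closed\<close>)
    qed
  qed
  then show ?thesis
    using that by metis
qed

text \<open>If a matrix over \<open>S\<close> fixes a nonzero vector over the whole field, then it also fixes one
  over \<open>S\<close>.\<close>

lemma fixed_point_free_field:
  assumes "reduced_word w" "w \<noteq> []" "u \<noteq> (0, 0)"
  shows "sl2.word f w u \<noteq> u"
proof
  assume fixed: "sl2.word f w u = u"
  obtain a b c d where abcd: "a \<in> S" "b \<in> S" "c \<in> S" "d \<in> S"
    and eq: "\<And>x y. sl2.word f w (x, y) = (a * x + b * y, c * x + d * y)"
    using word_linear[of w] by metis
  obtain x y where u: "u = (x, y)"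
    by fastforce
  have xy: "a * x + b * y = x" "c * x + d * y = y" "x \<noteq> 0 \<or> y \<noteq> 0"
    using fixed assms(3) by (auto simp: u eq)
  \<comment> \<open>For \<open>M\<close> with rows \<open>(a, b)\<close> and \<open>(c, d)\<close>,
    this is the adjugate of \<open>M - 1\<close> applied to \<open>(M - 1) u\<close>.\<close>
  have "((a - 1) * (d - 1) - b * c) * x =
      (d - 1) * (a * x + b * y - x) - b * (c * x + d * y - y)"
    "((a - 1) * (d - 1) - b * c) * y =
      (a - 1) * (c * x + d * y - y) - c * (a * x + b * y - x)"
    by (simp_all add: algebra_simps)
  then have det: "(a - 1) * (d - 1) - b * c = 0"
    using xy by auto
  \<comment> \<open>Up to sign these are the columns of that adjugate, killed by
    \<open>M - 1\<close> as its determinant vanishes. If both are zero, \<open>M\<close> is the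
    identity.\<close>
  have "sl2.word f w (b, 1 - a) = (b, 1 - a)" "sl2.word f w (1 - d, c) = (1 - d, c)"
    using det by (auto simp: eq algebra_simps)
  then have "b = 0" "a = 1" "d = 1" "c = 0"
    using fixed_point_free_S[OF assms(1,2), of "(b, 1 - a)"]
      fixed_point_free_S[OF assms(1,2), of "(1 - d, c)"] abcd closed by auto
  then have "sl2.word f w (1, 0) = (1, 0)"
    by (simp add: eq)
  then show False
    using fixed_point_free_S[OF assms(1,2), of "(1, 0)"] closed by simp
qed

sublocale free_letters "sl2_act f" "- {(0, 0)}"
  by unfold_locales (auto simp: sl2_act_eq_zero_iff fixed_point_free_field)

end

section \<open>The normed subrings\<close>

text \<open>The usual absolute value, carried over to the image of the integers; this is well
  defined since \<open>of_int\<close> is injective in characteristic 0.\<close>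

lemma normed_subring_Ints:
  assumes "CHAR('k::field) = 0"
  obtains N where "normed_subring (\<int> :: 'k set) N" "N 3 = 3" "N 6 = 6"
proof -
  define N :: "'k \<Rightarrow> real" where "N x = \<bar>of_int (THE i. x = of_int i)\<bar>" for x
  have inj: "(of_int i :: 'k) = of_int j \<longleftrightarrow> i = j" for i j
    using assms of_int_eq_0_iff_char_dvd[of "i - j", where ?'a = 'k] by simp
  have N: "N (of_int i) = \<bar>of_int i\<bar>" for i
    by (simp add: N_def inj)
  show ?thesis
  proof (rule that)
    show "normed_subring (\<int> :: 'k set) N"
    proof
      fix x y :: 'k assume "x \<in> \<int>" "y \<in> \<int>"
      then obtain i j where ij: "x = of_int i" "y = of_int j"
        by (auto elim!: Ints_cases)
      show "N (x * y) = N x * N y"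
        using N[of "i * j"] by (simp add: ij N abs_mult)
      show "N (x - y) \<le> N x + N y"
        using N[of "i - j"] by (simp add: ij N)
    next
      fix x :: 'k assume "x \<in> \<int>" "x \<noteq> 0"
      then show "N x > 0"
        by (auto elim!: Ints_cases simp: N)
    qed (use N[of 0] in auto)
    show "N 3 = 3" "N 6 = 6"
      using N[of 3] N[of 6] by simp_all
  qed
qed

section \<open>Valuations and the ring of integers\<close>

context nonarch_valuation
begin

lemma v_one: "v 1 = 1"
  using mult[of 1 1] eq_zero_iff[of 1] by simp

lemma v_zero: "v 0 = 0"
  by (simp add: eq_zero_iff)

lemma v_uminus: "v (- x) = v x"
proof -
  have "v (- 1) * v (- 1) = 1"
    using mult[of "- 1" "- 1"] v_one by simp
  then have "v (- 1) = 1"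
    using nonneg[of "- 1"] by (simp add: square_eq_1_iff)
  then show ?thesis
    using mult[of "- 1" x] by simp
qed

lemma ring_of_integers_closed:
  "0 \<in> ring_of_integers v" "1 \<in> ring_of_integers v"
  "\<lbrakk>x \<in> ring_of_integers v; y \<in> ring_of_integers v\<rbrakk> \<Longrightarrow> x + y \<in> ring_of_integers v"
  "\<lbrakk>x \<in> ring_of_integers v; y \<in> ring_of_integers v\<rbrakk> \<Longrightarrow> x * y \<in> ring_of_integers v"
  "x \<in> ring_of_integers v \<Longrightarrow> - x \<in> ring_of_integers v"
  using ultrametric[of x y] nonneg
  by (auto simp: ring_of_integers_def v_one v_zero v_uminus mult intro: mult_le_one)

lemma Ints_subset_ring_of_integers: "\<int> \<subseteq> ring_of_integers v"
proof -
  have "of_nat n \<in> ring_of_integers v" for n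
    by (induction n) (auto intro: ring_of_integers_closed)
  then have "of_int i \<in> ring_of_integers v" for i
    by (cases i rule: int_cases2) (auto intro: ring_of_integers_closed)
  then show ?thesis
    by (auto elim!: Ints_cases)
qed

text \<open>By Bezout, an integer prime to the characteristic has an inverse that is again an
  integer; both have valuation at most 1, and the product of the valuations is 1.\<close>

lemma v_Ints_eq_one:
  assumes "CHAR('k) > 0" "a \<in> \<int>" "a \<noteq> 0"
  shows "v a = 1"
proof -
  obtain i where i: "a = of_int i"
    using assms(2) by (auto elim: Ints_cases)
  let ?p = "int CHAR('k)"
  have "prime CHAR('k)"
    using assms(1) prime_CHAR_semidom by blast
  moreover have "\<not> ?p dvd i"
    using assms(3) i of_int_eq_0_iff_char_dvd by blast
  ultimately have "coprime i ?p"
    using prime_imp_coprime[of ?p i] by (simp add: coprime_commute)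
  then obtain r s where "r * i + s * ?p = 1"
    by (metis bezout_int coprime_imp_gcd_eq_1)
  then have "(of_int (r * i + s * ?p) :: 'k) = 1"
    by simp
  then have "of_int r * a = 1"
    by (simp add: i)
  then have "v (of_int r) * v a = 1"
    by (metis mult v_one)
  moreover have "v (of_int r) \<le> 1" "v a \<le> 1"
    using Ints_subset_ring_of_integers assms(2) Ints_of_int by (fastforce simp: ring_of_integers_def)+
  ultimately show ?thesis
    using nonneg[of a] nonneg[of "of_int r"] mult_left_le_one_le[of "v a" "v (of_int r)"] by simp
qed

lemma ex_v_less_one:
  assumes "nontrivial_valuation v"
  obtains t where "t \<noteq> 0" "v t < 1"
proof -
  \<comment> \<open>As 1 is always a value, nontriviality yields another one; the element or its
    inverse will do.\<close>
  have "1 \<in> {v x | x. x \<noteq> 0}"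
    using v_one by (metis (mono_tags, lifting) mem_Collect_eq zero_neq_one)
  then obtain x where x: "x \<noteq> 0" "v x \<noteq> 1"
    using assms by (auto simp: nontrivial_valuation_def)
  have "v x * v (inverse x) = 1"
    using mult[of x "inverse x"] x v_one by simp
  then have "v (inverse x) < 1" if "v x > 1"
    using that mult_le_cancel_left1[of "v x" "v (inverse x)"] by auto
  then show ?thesis
    using that[of x] that[of "inverse x"] x by fastforce
qed

text \<open>\<open>S\<close> consists of the polynomials in \<open>t\<close> over the prime field,
  where \<open>0 < v t < 1\<close>. Transcendence of \<open>t\<close> makes the degree well defined
  on \<open>S\<close>; base 3 gives norm above 2 already in degree 1.\<close>

lemma normed_subring_polys:
  assumes "CHAR('k) > 0" "nontrivial_valuation v"
  obtains S N t where "normed_subring S N" "S \<subseteq> ring_of_integers v" "t \<in> S"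
    "N t = 3" "N (t * t) = 9" "N (t * t - t) = 9"
proof -
  obtain t where t: "t \<noteq> 0" "v t < 1"
    using ex_v_less_one[OF assms(2)] .
  \<comment> \<open>\<open>\<int>\<close> is the image of the integers, here the prime
    field.\<close>
  define P :: "'k poly set" where "P = {q. \<forall>i. coeff q i \<in> \<int>}"
  have pCons_P: "pCons a q \<in> P \<longleftrightarrow> a \<in> \<int> \<and> q \<in> P" for a q
    by (auto simp: P_def coeff_pCons split: nat.splits)
  have t_in: "t \<in> ring_of_integers v"
    using t by (simp add: ring_of_integers_def)
  have poly_in: "poly q t \<in> ring_of_integers v" if "q \<in> P" for q
    using that
    by (induction q)
      (use Ints_subset_ring_of_integers in \<open>auto simp: pCons_P t_in intro!: ring_of_integers_closed\<close>)
  text \<open>\<open>t\<close> is transcendental over the prime field: the lowest nonzero term of \<open>q\<close> dominates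
    \<open>poly q t\<close>.\<close>
  have poly_eq_0: "q = 0" if "q \<in> P" "poly q t = 0" for q
    using that
  proof (induction q)
    case (pCons a q)
    have "v (t * poly q t) < 1"
    proof -
      have "v t * v (poly q t) \<le> v t"
        using poly_in[of q] pCons.prems nonneg by (auto simp: pCons_P ring_of_integers_def mult_left_le)
      then show ?thesis
        using t by (simp add: mult)
    qed
    moreover have "a = - (t * poly q t)"
      using pCons.prems by (simp add: eq_neg_iff_add_eq_0)
    ultimately have "v a < 1"
      by (simp add: v_uminus)
    then have "a = 0"
      using v_Ints_eq_one[OF assms(1)] pCons.prems by (force simp: pCons_P)
    then show ?case
      using pCons t by (simp add: pCons_P)
  qed simp
  have P_diff: "q - r \<in> P" if "q \<in> P" "r \<in> P" for q r
    using that by (auto simp: P_def)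
  have P_mult: "q * r \<in> P" if "q \<in> P" "r \<in> P" for q r
    using that by (auto simp: P_def coeff_mult intro!: Ints_sum Ints_mult)
  have inj: "q = r" if "q \<in> P" "r \<in> P" "poly q t = poly r t" for q r
    using poly_eq_0[of "q - r"] P_diff that by simp
  \<comment> \<open>Since \<open>degree 0 = 0\<close>, the power alone would give the zero
    polynomial norm 1.\<close>
  define deg where "deg q = (if q = 0 then 0 else 3 ^ degree q :: real)" for q :: "'k poly"
  define N where "N x = deg (THE q. q \<in> P \<and> poly q t = x)" for x
  have N: "N (poly q t) = deg q" if "q \<in> P" for q
  proof -
    have "(THE r. r \<in> P \<and> poly r t = poly q t) = q"
      using that inj by blast
    then show ?thesis
      by (simp add: N_def)
  qed
  have P0: "0 \<in> P" "1 \<in> P" "[:0, 1:] \<in> P"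
    by (auto simp: P_def coeff_pCons split: nat.splits)
  define S where "S = (\<lambda>q. poly q t) ` P"
  have "normed_subring S N"
  proof
    show "0 \<in> S" "1 \<in> S"
      using P0 by (force simp: S_def)+
    show "N 0 = 0"
      using N[OF P0(1)] by (simp add: deg_def)
  next
    fix x y assume "x \<in> S" "y \<in> S"
    then obtain q r where qr: "q \<in> P" "r \<in> P" "x = poly q t" "y = poly r t"
      by (auto simp: S_def)
    have "x - y = poly (q - r) t" "x * y = poly (q * r) t"
      by (simp_all add: qr)
    then show "x - y \<in> S" "x * y \<in> S"
      unfolding S_def using qr P_diff P_mult by blast+
    have "N (x * y) = deg (q * r)"
      using N[OF P_mult] qr by simp
    then show "N (x * y) = N x * N y"
      using qr by (simp add: N deg_def degree_mult_eq power_add)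
    have "N (x - y) = deg (q - r)"
      using N[OF P_diff] qr by simp
    also have "\<dots> \<le> deg q + deg r"
    proof (cases "q = 0 \<or> r = 0")
      case False
      have "(3::real) ^ degree (q - r) \<le> 3 ^ max (degree q) (degree r)"
        by (intro power_increasing degree_diff_le_max) auto
      also have "\<dots> \<le> 3 ^ degree q + 3 ^ degree r"
        by (auto simp: max_def)
      finally show ?thesis
        using False by (auto simp: deg_def)
    qed (auto simp: deg_def)
    finally show "N (x - y) \<le> N x + N y"
      using qr by (simp add: N)
  next
    fix x assume "x \<in> S" "x \<noteq> 0"
    then show "N x > 0"
      by (auto simp: S_def N deg_def)
  qed
  moreover have "S \<subseteq> ring_of_integers v"
    using poly_in by (auto simp: S_def)
  moreover have "t \<in> S"
    using P0(3) by (force simp: S_def)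
  moreover have "N t = 3" "N (t * t) = 9" "N (t * t - t) = 9"
  proof -
    let ?T = "[:0, 1:] :: 'k poly"
    have TT: "?T * ?T = [:0, 0, 1:]" "?T * ?T - ?T = [:0, - 1, 1:]"
      by simp_all
    have "N (poly ?T t) = deg ?T" "N (poly (?T * ?T) t) = deg (?T * ?T)"
      "N (poly (?T * ?T - ?T) t) = deg (?T * ?T - ?T)"
      using P0 P_mult P_diff by (intro N; blast)+
    then show "N t = 3" "N (t * t) = 9" "N (t * t - t) = 9"
      unfolding TT by (simp_all add: deg_def algebra_simps)
  qed
  ultimately show ?thesis
    using that by blast
qed

end

section \<open>Special affine maps\<close>

no_notation fps_nth (infixl \<open>$\<close> 75)

lemma special_affineI:
  fixes \<tau> :: "'k::field ^ 'n"
  assumes "M \<in> special_linear L" "\<And>i. \<tau> $ i \<in> L"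
  shows "(\<lambda>x. M *v x + \<tau>) \<in> special_affine L"
  using assms by (auto simp: special_affine_def)

locale subring_set =
  fixes L :: "'k::field set"
  assumes zero_closed: "0 \<in> L" and one_closed: "1 \<in> L"
    and uminus_closed: "x \<in> L \<Longrightarrow> - x \<in> L"
    and add_closed: "\<lbrakk>x \<in> L; y \<in> L\<rbrakk> \<Longrightarrow> x + y \<in> L"
    and mult_closed: "\<lbrakk>x \<in> L; y \<in> L\<rbrakk> \<Longrightarrow> x * y \<in> L"
begin

lemma sum_closed: "(\<And>i. i \<in> I \<Longrightarrow> h i \<in> L) \<Longrightarrow> sum h I \<in> L"
  by (induction I rule: infinite_finite_induct) (auto simp: zero_closed add_closed)

lemma translation_special_affine:
  fixes \<tau> :: "'k ^ 'n"
  assumes "\<And>i. \<tau> $ i \<in> L"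
  shows "(\<lambda>x. x + \<tau>) \<in> special_affine L"
proof -
  have "mat 1 \<in> (special_linear L :: ('k ^ 'n ^ 'n) set)"
    by (simp add: special_linear_def) (simp add: mat_def zero_closed one_closed)
  from special_affineI[OF this assms] show ?thesis
    by simp
qed

lemma id_special_affine: "(\<lambda>x. x) \<in> special_affine L"
  using translation_special_affine[of 0] zero_closed by simp

lemma special_affine_comp:
  fixes g h :: "'k ^ 'n \<Rightarrow> 'k ^ 'n"
  assumes "g \<in> special_affine L" "h \<in> special_affine L"
  shows "(\<lambda>x. g (h x)) \<in> special_affine L"
proof -
  obtain M M' and \<tau> \<tau>' :: "'k ^ 'n" where M: "M \<in> special_linear L" "M' \<in> special_linear L"
    and \<tau>: "\<And>i. \<tau> $ i \<in> L" "\<And>i. \<tau>' $ i \<in> L"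
    and gh: "g = (\<lambda>x. M *v x + \<tau>)" "h = (\<lambda>x. M' *v x + \<tau>')"
    using assms by (auto simp: special_affine_def)
  have "(M ** M') $ i $ j \<in> L" for i j
    using M by (auto simp: special_linear_def matrix_matrix_mult_def intro!: sum_closed mult_closed)
  then have "M ** M' \<in> special_linear L"
    using M by (simp add: special_linear_def det_mul)
  moreover have "(M *v \<tau>' + \<tau>) $ i \<in> L" for i
    using M \<tau> by (auto simp: special_linear_def matrix_vector_mult_def
        intro!: sum_closed mult_closed add_closed)
  ultimately have "(\<lambda>x. (M ** M') *v x + (M *v \<tau>' + \<tau>)) \<in> special_affine L"
    by (rule special_affineI)
  then show ?thesis
    by (simp add: gh matrix_vector_mul_assoc matrix_vector_right_distrib add.assoc)
qed

text \<open>The matrix arises from the identity by adding \<open>c\<close> times row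
  \<open>j\<close> to row \<open>i\<close>, which preserves the determinant.\<close>

lemma transvection_special_affine:
  fixes i j :: "'n::finite"
  assumes "c \<in> L" "i \<noteq> j"
  shows "(\<lambda>x. x + axis i (c * x $ j)) \<in> special_affine L"
proof -
  define M :: "'k ^ 'n ^ 'n"
    where "M = (\<chi> k. if k = i then row i (mat 1) + c *s row j (mat 1) else row k (mat 1))"
  have M_nth: "M $ k $ l = (if k = l then 1 else 0) + (if k = i \<and> l = j then c else 0)" for k l
    by (auto simp: M_def row_def mat_def)
  have "det M = 1"
    unfolding M_def by (rule trans[OF det_row_operation[OF assms(2)] det_I])
  then have "M \<in> special_linear L"
    using assms zero_closed one_closed add_closed by (auto simp: special_linear_def M_nth)
  then have "(\<lambda>x. M *v x + 0) \<in> special_affine L"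
    by (rule special_affineI) (simp add: zero_closed)
  moreover have "M *v x + 0 = x + axis i (c * x $ j)" for x
  proof -
    have "(M *v x) $ k = x $ k + (if k = i then c * x $ j else 0)" for k
      by (simp add: matrix_vector_mult_def M_nth distrib_right sum.distrib if_distrib[of "\<lambda>z. z * _"]
          cong: if_cong)
    then show ?thesis
      by (auto simp: vec_eq_iff axis_def)
  qed
  ultimately show ?thesis
    by simp
qed

end

text \<open>Written as a composition of two transvections of the whole space, so that it is special
  affine by closure under composition.\<close>

definition sl2_lift :: "(bool \<Rightarrow> 'k) \<Rightarrow> 'n \<Rightarrow> 'n \<Rightarrow> letter \<Rightarrow> 'k ^ 'n \<Rightarrow> 'k::field ^ 'n::finite" where
  "sl2_lift f i j s x =
     (if snd s
      then (\<lambda>x. x + axis i (f (fst s) * x $ j)) (x + axis j (f (fst s) * x $ i))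
      else (\<lambda>x. x + axis j (- f (fst s) * x $ i)) (x + axis i (- f (fst s) * x $ j)))"

lemma sl2_lift_proj:
  assumes "i \<noteq> j"
  shows "(sl2_lift f i j s x $ i, sl2_lift f i j s x $ j) = sl2_act f s (x $ i, x $ j)"
  using assms by (cases s; cases "snd s") (auto simp: sl2_lift_def axis_def)

lemma sl2_lift_letter_inv:
  assumes "i \<noteq> j"
  shows "sl2_lift f i j s (sl2_lift f i j (letter_inv s) x) = x"
  using assms by (auto simp: sl2_lift_def letter_inv_def vec_eq_iff axis_def)

lemma (in subring_set) sl2_lift_special_affine:
  assumes "\<And>b. f b \<in> L" "i \<noteq> j"
  shows "sl2_lift f i j s \<in> special_affine L"
proof (cases "snd s")
  case True
  have "(\<lambda>x. x + axis i (f (fst s) * x $ j)) \<in> special_affine L"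
    "(\<lambda>x. x + axis j (f (fst s) * x $ i)) \<in> special_affine L"
    using assms by (auto intro: transvection_special_affine)
  from special_affine_comp[OF this] show ?thesis
    using True by (simp add: sl2_lift_def[abs_def])
next
  case False
  have "(\<lambda>x. x + axis j (- f (fst s) * x $ i)) \<in> special_affine L"
    "(\<lambda>x. x + axis i (- f (fst s) * x $ j)) \<in> special_affine L"
    by (intro transvection_special_affine uminus_closed assms(1) assms(2) assms(2)[symmetric])+
  from special_affine_comp[OF this] show ?thesis
    using False by (simp add: sl2_lift_def[abs_def])
qed

text \<open>Lets decompositions of the plane be pulled back along the projection. The lift of the
  inverse letter supplies the preimages.\<close>

lemma image_sl2_lift:
  fixes i j :: "'n::finite"
  assumes "i \<noteq> j"
  shows "sl2_lift f i j s ` {x. (x $ i, x $ j) \<in> R} = {x. (x $ i, x $ j) \<in> sl2_act f s ` R}"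
proof (intro equalityI subsetI)
  fix y assume "y \<in> sl2_lift f i j s ` {x. (x $ i, x $ j) \<in> R}"
  then obtain x where "(x $ i, x $ j) \<in> R" "y = sl2_lift f i j s x"
    by blast
  then show "y \<in> {x. (x $ i, x $ j) \<in> sl2_act f s ` R}"
    by (simp add: sl2_lift_proj[OF assms])
next
  fix y assume "y \<in> {x. (x $ i, x $ j) \<in> sl2_act f s ` R}"
  then obtain r where r: "r \<in> R" "(y $ i, y $ j) = sl2_act f s r"
    by auto
  let ?x = "sl2_lift f i j (letter_inv s) y"
  have "(?x $ i, ?x $ j) = r"
    by (simp add: sl2_lift_proj[OF assms] r sl2.act_letter_inv)
  then show "y \<in> sl2_lift f i j s ` {x. (x $ i, x $ j) \<in> R}"
    using r(1) sl2_lift_letter_inv[OF assms, of f s y] by (intro rev_image_eqI[of ?x]) auto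
qed

section \<open>The five pieces\<close>

lemma equidecomposable_single: "g \<in> G \<Longrightarrow> equidecomposable G 1 A (g ` A)"
  unfolding equidecomposable_def
  by (intro exI[of _ "\<lambda>_. A"] exI[of _ "\<lambda>_. g ` A"] exI[of _ "\<lambda>_. g"])
    (auto simp: disjoint_family_on_def)

text \<open>The second family is appended with its indices shifted by \<open>m\<close>, so the piece
  counts add.\<close>

lemma equidecomposable_Un:
  assumes "equidecomposable G m A B" "equidecomposable G l A' B'" "A \<inter> A' = {}" "B \<inter> B' = {}"
  shows "equidecomposable G (m + l) (A \<union> A') (B \<union> B')"
proof -
  obtain P Q g where 1: "disjoint_family_on P {..<m}" "(\<Union>i<m. P i) = A"
    "disjoint_family_on Q {..<m}" "(\<Union>i<m. Q i) = B" "\<forall>i<m. g i \<in> G \<and> g i ` P i = Q i"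
    using assms(1) unfolding equidecomposable_def by (elim exE conjE) (rule that; assumption)
  obtain P' Q' g' where 2: "disjoint_family_on P' {..<l}" "(\<Union>i<l. P' i) = A'"
    "disjoint_family_on Q' {..<l}" "(\<Union>i<l. Q' i) = B'" "\<forall>i<l. g' i \<in> G \<and> g' i ` P' i = Q' i"
    using assms(2) unfolding equidecomposable_def by (elim exE conjE) (rule that; assumption)
  have disj: "disjoint_family_on (\<lambda>i. if i < m then R i else R' (i - m)) {..<m + l}"
    and union: "(\<Union>i<m + l. if i < m then R i else R' (i - m)) = C \<union> C'"
    if R: "disjoint_family_on R {..<m}" "(\<Union>i<m. R i) = C"
      "disjoint_family_on R' {..<l}" "(\<Union>i<l. R' i) = C'" "C \<inter> C' = {}"
    for R R' :: "nat \<Rightarrow> 'a set" and C C'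
  proof -
    have "R i \<inter> R' (k - m) = {}" if "i < m" "\<not> k < m" "k < m + l" for i k
    proof -
      have "R i \<subseteq> C" "R' (k - m) \<subseteq> C'"
        using R that by auto
      then show ?thesis
        using R(5) by blast
    qed
    moreover have "R' (i - m) \<inter> R' (k - m) = {}"
      if "\<not> i < m" "\<not> k < m" "i < m + l" "k < m + l" "i \<noteq> k" for i k
      using that by (intro disjoint_family_onD[OF R(3)]) auto
    moreover have "R i \<inter> R k = {}" if "i < m" "k < m" "i \<noteq> k" for i k
      using that by (intro disjoint_family_onD[OF R(1)]) auto
    ultimately show "disjoint_family_on (\<lambda>i. if i < m then R i else R' (i - m)) {..<m + l}"
      by (auto simp: disjoint_family_on_def Int_commute)
    have "k \<in> (\<lambda>i. i + m) ` {..<l}" if "k < m + l" "\<not> k < m" for k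
      using that by (intro image_eqI[of _ _ "k - m"]) auto
    then have "{..<m + l} = {..<m} \<union> (\<lambda>i. i + m) ` {..<l}"
      by auto
    then show "(\<Union>i<m + l. if i < m then R i else R' (i - m)) = C \<union> C'"
      using R(2,4) by auto
  qed
  show ?thesis
    unfolding equidecomposable_def
  proof (intro exI conjI)
    show "disjoint_family_on (\<lambda>i. if i < m then P i else P' (i - m)) {..<m + l}"
      by (rule disj[OF 1(1,2) 2(1,2) assms(3)])
    show "(\<Union>i<m + l. if i < m then P i else P' (i - m)) = A \<union> A'"
      by (rule union[OF 1(1,2) 2(1,2) assms(3)])
    show "disjoint_family_on (\<lambda>i. if i < m then Q i else Q' (i - m)) {..<m + l}"
      by (rule disj[OF 1(3,4) 2(3,4) assms(4)])
    show "(\<Union>i<m + l. if i < m then Q i else Q' (i - m)) = B \<union> B'"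
      by (rule union[OF 1(3,4) 2(3,4) assms(4)])
    show "\<forall>i<m + l. (if i < m then g i else g' (i - m)) \<in> G \<and>
        (if i < m then g i else g' (i - m)) ` (if i < m then P i else P' (i - m)) =
        (if i < m then Q i else Q' (i - m))"
    proof (intro allI impI)
      fix i assume "i < m + l"
      then show "(if i < m then g i else g' (i - m)) \<in> G \<and>
          (if i < m then g i else g' (i - m)) ` (if i < m then P i else P' (i - m)) =
          (if i < m then Q i else Q' (i - m))"
        using 1(5)[rule_format, of i] 2(5)[rule_format, of "i - m"] by (cases "i < m") simp_all
    qed
  qed
qed

lemma paradoxical_if_ping_pong:
  fixes L :: "'k::field set"
  assumes "ping_pong S N f" "subring_set L" "S \<subseteq> L" "CARD('n::finite) \<ge> 2"
  shows "paradoxical_using (special_affine L :: ('k ^ 'n \<Rightarrow> 'k ^ 'n) set) 5 UNIV"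
proof -
  interpret ping_pong S N f by fact
  interpret subring_set L by fact
  have f_L: "f b \<in> L" for b
    using f_in assms(3) by auto
  obtain i j :: 'n where ij: "i \<noteq> j"
    using assms(4) card_le_Suc0_iff_eq[of "UNIV :: 'n set"] by auto
  let ?G = "special_affine L :: ('k ^ 'n \<Rightarrow> 'k ^ 'n) set"
  let ?a = "(False, True)" and ?b = "(True, True)"
  \<comment> \<open>\<open>(1, 0)\<close> is left out because a translation with entries in
    \<open>L\<close> takes it to the origin.\<close>
  have "(1, 0) \<in> - {(0::'k, 0::'k)}"
    by simp
  then obtain A1 A2 A3 A4 where disj: "A1 \<inter> A2 = {}" "A3 \<inter> A4 = {}" "(A1 \<union> A2) \<inter> (A3 \<union> A4) = {}"
    and union: "A1 \<union> A2 \<union> A3 \<union> A4 = - {(0, 0)} - {(1, 0)}"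
    and image: "sl2_act f ?a ` A2 = - {(0, 0)} - A1" "sl2_act f ?b ` A4 = - {(0, 0)} - A3"
    by (rule paradoxical_minus_point)
  define pre :: "('k \<times> 'k) set \<Rightarrow> ('k ^ 'n) set" where "pre R = {x. (x $ i, x $ j) \<in> R}" for R
  have pre: "pre R \<union> pre R' = pre (R \<union> R')" "pre R \<inter> pre R' = pre (R \<inter> R')"
    "pre {} = {}" "pre UNIV = UNIV" for R R'
    by (auto simp: pre_def)
  \<comment> \<open>The origin joins \<open>A1\<close>, which stays in place; the fibre over
    \<open>(1, 0)\<close> is the fifth piece.\<close>
  let ?A = "pre (insert (0, 0) A1) \<union> pre A2"
  let ?B = "pre A3 \<union> pre A4 \<union> pre {(1, 0)}"
  have keep: "equidecomposable ?G 1 (pre R) (pre R)" for R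
    using equidecomposable_single[OF id_special_affine, of "pre R"] by simp
  have move: "equidecomposable ?G 1 (pre R) (pre (sl2_act f s ` R))" for R s
  proof -
    have "sl2_lift f i j s \<in> ?G"
      by (rule sl2_lift_special_affine[OF f_L ij])
    from equidecomposable_single[OF this, of "pre R"] show ?thesis
      by (simp add: pre_def image_sl2_lift[OF ij])
  qed
  have shift: "equidecomposable ?G 1 (pre {(1, 0)}) (pre {(0, 0)})"
  proof -
    have "(\<lambda>x. x + axis i (- 1)) \<in> ?G"
      by (intro translation_special_affine) (auto simp: axis_def zero_closed one_closed uminus_closed)
    moreover have "(\<lambda>x. x + axis i (- 1)) ` pre {(1, 0)} = pre {(0, 0)}"
    proof (intro equalityI subsetI)
      fix y assume "y \<in> pre {(0, 0)}"
      then show "y \<in> (\<lambda>x. x + axis i (- 1)) ` pre {(1, 0)}"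
        using ij by (intro rev_image_eqI[of "y + axis i 1"]) (auto simp: pre_def axis_def vec_eq_iff)
    qed (use ij in \<open>auto simp: pre_def axis_def\<close>)
    ultimately show ?thesis
      using equidecomposable_single by metis
  qed
  have "equidecomposable ?G (1 + 1) ?A (pre (insert (0, 0) A1) \<union> pre (- {(0, 0)} - A1))"
    using move[of A2 ?a] union disj unfolding image
    by (intro equidecomposable_Un keep) (auto simp: pre)
  moreover have "pre (insert (0, 0) A1) \<union> pre (- {(0, 0)} - A1) = UNIV"
    by (auto simp: pre_def)
  ultimately have A: "equidecomposable ?G 2 ?A UNIV"
    by (simp add: numeral_2_eq_2)
  \<comment> \<open>\<open>A3\<close> and the moved \<open>A4\<close> cover just the nonzero
    vectors, so the translated fibre has to cover the origin.\<close>
  have "equidecomposable ?G (1 + 1 + 1) ?B (pre A3 \<union> pre (- {(0, 0)} - A3) \<union> pre {(0, 0)})"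
    using move[of A4 ?b] union disj unfolding image
    by (intro equidecomposable_Un keep shift) (auto simp: pre)
  moreover have "pre A3 \<union> pre (- {(0, 0)} - A3) \<union> pre {(0, 0)} = UNIV"
    by (auto simp: pre_def)
  ultimately have B: "equidecomposable ?G 3 ?B UNIV"
    by (simp add: numeral_3_eq_3)
  have "?A \<inter> ?B = {}"
  proof -
    have "(0, 0) \<notin> A1 \<union> A2 \<union> A3 \<union> A4" "(1, 0) \<notin> A1 \<union> A2 \<union> A3 \<union> A4"
      unfolding union by simp_all
    then have "(insert (0, 0) A1 \<union> A2) \<inter> (A3 \<union> A4 \<union> {(1, 0)}) = {}"
      using disj by auto
    then show ?thesis
      by (simp only: pre)
  qed
  moreover have "?A \<union> ?B = UNIV"
  proof -
    have "insert (0, 0) A1 \<union> A2 \<union> (A3 \<union> A4 \<union> {(1, 0)}) =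
        insert (0, 0) (insert (1, 0) (A1 \<union> A2 \<union> A3 \<union> A4))"
      by blast
    also have "\<dots> = UNIV"
      unfolding union by blast
    finally show ?thesis
      by (simp only: pre)
  qed
  ultimately have "?A \<inter> ?B = {} \<and> ?A \<union> ?B = UNIV \<and> 1 \<le> (2::nat) \<and> 1 \<le> (3::nat) \<and>
      2 + 3 = (5::nat) \<and> equidecomposable ?G 2 ?A UNIV \<and> equidecomposable ?G 3 ?B UNIV"
    using A B by (intro conjI) simp_all
  then show ?thesis
    unfolding paradoxical_using_def by (intro conjI UNIV_not_empty) (rule exI)+
qed

theorem theorem5p7:
  fixes v :: "'k::field \<Rightarrow> real"
  assumes "nonarch_valuation v"
    and "nontrivial_valuation v"
    and "CARD('n::finite) \<ge> 2"
  shows "paradoxical_using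
           (special_affine (if CHAR('k) = 0 then \<int> else ring_of_integers v)
              :: ('k ^ 'n \<Rightarrow> 'k ^ 'n) set)
           5 UNIV"
proof (cases "CHAR('k) = 0")
  case True
  obtain N where N: "normed_subring (\<int> :: 'k set) N" "N 3 = 3" "N 6 = 6"
    using normed_subring_Ints[OF True] .
  interpret normed_subring "\<int> :: 'k set" N by fact
  \<comment> \<open>The parameters 3 and 6 and their difference have norm above 2;
    \<open>- 3\<close> occurs because separation is required in both orders.\<close>
  have "N (- 3) = 3"
    using N_uminus[of 3] N by simp
  then have ping_pong: "ping_pong \<int> N (\<lambda>b. if b then 6 else 3)"
    using N by unfold_locales auto
  have "subring_set (\<int> :: 'k set)"
    by unfold_locales auto
  from paradoxical_if_ping_pong[OF ping_pong this order_refl assms(3)] show ?thesis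
    using True by simp
next
  case False
  interpret nonarch_valuation v by fact
  obtain S N t where S: "normed_subring S N" "S \<subseteq> ring_of_integers v" "t \<in> S"
    and N: "N t = 3" "N (t * t) = 9" "N (t * t - t) = 9"
    using normed_subring_polys[OF _ assms(2)] False by auto
  interpret normed_subring S N by fact
  \<comment> \<open>Again both orders of the difference are required, now for the parameters
    \<open>t\<close> and \<open>t * t\<close>.\<close>
  have "N (t - t * t) = 9"
    using N_uminus[of "t * t - t"] N S(3) closed by simp
  then have ping_pong: "ping_pong S N (\<lambda>b. if b then t * t else t)"
    using N S(3) closed by unfold_locales auto
  have "subring_set (ring_of_integers v)"
    by unfold_locales (auto intro: ring_of_integers_closed)
  from paradoxical_if_ping_pong[OF ping_pong this S(2) assms(3)] show ?thesis
    using False by simp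
qed

end
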